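(* Let $\alpha,\gamma\in\mathbb{C}$ with $\gamma\neq 0,-1,-2,\cdots$, and let $f(z)={}_{1}F_{1}(\alpha;\gamma;z)$ be the confluent hypergeometric function. If $\alpha\notin\mathbb{Z}_{\leq 0}$ and $\gamma-\alpha\notin\mathbb{Z}_{\leq 0}$, then for every $\epsilon>0$, $$n\left(r,\frac{1}{f}\right)=n(r)=O(r^{1+\epsilon})$$ when $r$ is sufficiently large.
   Context: For $\alpha,\gamma\in\mathbb{C}$ with $\gamma\neq 0,-1,-2,\cdots$, the confluent hypergeometric (Kummer) function is the entire function of $z$ given by ${}_{1}F_{1}(\alpha;\gamma;z):=\sum_{n=0}^{\infty}\frac{(\alpha)_{n}}{n!(\gamma)_{n}}z^{n}$, where $(\alpha)_0=1$ and $(\alpha)_{n}=\alpha(\alpha+1)\cdots(\alpha+n-1)$. $\mathbb{Z}_{\leq 0}=\{0,-1,-2,\cdots\}$. $n(r,1/f)$ denotes the number of poles of $1/f$ (equivalently, zeros of the entire function $f$) in the closed disc $\{z:|z|\leq r\}$, counted with multiplicity, and $n(r)$ denotes the number of nonzero zeros of $f$ in $\{z:|z|\leq r\}$, counted with multiplicity. *)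

theory Defs
  imports
    "HOL-Complex_Analysis.Complex_Analysis"
    "HOL-Library.Landau_Symbols"
    "HOL-Library.Nonpos_Ints"
begin

definition kummer :: "complex \<Rightarrow> complex \<Rightarrow> complex \<Rightarrow> complex" where
  "kummer \<alpha> \<gamma> z = (\<Sum>n. pochhammer \<alpha> n / (fact n * pochhammer \<gamma> n) * z ^ n)"

text \<open>
  \<open>pole_count g r\<close> is the Nevanlinna counting function $n(r, g)$: the pole of \<open>g\<close> at \<open>p\<close> has
  multiplicity \<open>- zorder g p\<close>. Both sums below would degenerate to \<open>0\<close> over an infinite index set;
  for the functions of interest the index sets are finite by the lemmas at the end of this theory.
\<close>

definition pole_count :: "(complex \<Rightarrow> complex) \<Rightarrow> real \<Rightarrow> nat" where
  "pole_count g r = (\<Sum>p | norm p \<le> r \<and> is_pole g p. nat (- zorder g p))"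

definition nonzero_zero_count :: "(complex \<Rightarrow> complex) \<Rightarrow> real \<Rightarrow> nat" where
  "nonzero_zero_count f r = (\<Sum>z | norm z \<le> r \<and> z \<noteq> 0 \<and> f z = 0. nat (zorder f z))"

lemma kummer_sums:
  assumes "\<gamma> \<notin> \<int>\<^sub>\<le>\<^sub>0"
  shows "(\<lambda>n. pochhammer \<alpha> n / (fact n * pochhammer \<gamma> n) * z ^ n) sums kummer \<alpha> \<gamma> z"
proof -
  define c where "c n = pochhammer \<alpha> n / (fact n * pochhammer \<gamma> n) * z ^ n" for n :: nat
  have "(\<lambda>n::nat. (\<alpha> / of_nat n + 1) / (\<gamma> / of_nat n + 1) * (z / of_nat (Suc n)))
          \<longlonglongrightarrow> (0 + 1) / (0 + 1) * 0"
    by (intro tendsto_intros lim_const_over_n LIMSEQ_Suc) auto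
  then have "\<forall>\<^sub>F n in sequentially.
      norm ((\<alpha> / of_nat n + 1) / (\<gamma> / of_nat n + 1) * (z / of_nat (Suc n))) < 1/2"
    by (auto simp: tendsto_iff dist_norm dest: spec[of _ "1/2"])
  then obtain N where N: "\<And>n. n \<ge> N \<Longrightarrow>
      norm ((\<alpha> / of_nat n + 1) / (\<gamma> / of_nat n + 1) * (z / of_nat (Suc n))) < 1/2"
    unfolding eventually_sequentially by blast
  have "summable c"
  proof (rule summable_ratio_test[of "1/2" "Suc N"])
    fix n assume n: "n \<ge> Suc N"
    have nz: "\<gamma> + of_nat n \<noteq> 0"
      using assms by (metis add_eq_0_iff2 nonpos_Ints_of_int of_int_minus of_int_of_nat_eq
          of_nat_0_le_iff neg_le_0_iff_le)
    have "c (Suc n) = (\<alpha> + of_nat n) / (\<gamma> + of_nat n) * (z / of_nat (Suc n)) * c n"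
      by (simp add: c_def pochhammer_Suc field_simps)
    also have "(\<alpha> + of_nat n) / (\<gamma> + of_nat n)
        = (\<alpha> / of_nat n + 1) / (\<gamma> / of_nat n + 1)"
    proof -
      have "\<alpha> / of_nat n + 1 = (\<alpha> + of_nat n) / of_nat n"
        "\<gamma> / of_nat n + 1 = (\<gamma> + of_nat n) / of_nat n"
        using n by (simp_all add: field_simps)
      then show ?thesis using n by simp
    qed
    finally show "norm (c (Suc n)) \<le> 1/2 * norm (c n)"
      using N[of n] n
      by (simp only: norm_mult) (intro mult_right_mono norm_ge_zero less_imp_le, simp)
  qed simp
  then show ?thesis
    unfolding kummer_def c_def by (rule summable_sums)
qed

lemma kummer_0 [simp]: "kummer \<alpha> \<gamma> 0 = 1"
  using powser_sums_zero[of "\<lambda>n. pochhammer \<alpha> n / (fact n * pochhammer \<gamma> n)"]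
  by (simp add: kummer_def sums_iff)

lemma kummer_holomorphic:
  assumes "\<gamma> \<notin> \<int>\<^sub>\<le>\<^sub>0"
  shows "kummer \<alpha> \<gamma> holomorphic_on A"
proof -
  have ball: "kummer \<alpha> \<gamma> holomorphic_on ball 0 r" for r
    by (rule power_series_holomorphic
          [where a = "\<lambda>n. pochhammer \<alpha> n / (fact n * pochhammer \<gamma> n)"])
       (use kummer_sums[OF assms] in simp)
  have "kummer \<alpha> \<gamma> field_differentiable at z" for z
    by (rule holomorphic_on_imp_differentiable_at[OF ball[of "norm z + 1"]]) auto
  then show ?thesis
    by (simp add: holomorphic_on_def field_differentiable_at_within)
qed

lemma finite_kummer_zeros:
  assumes "\<gamma> \<notin> \<int>\<^sub>\<le>\<^sub>0"
  shows "finite {z. norm z \<le> r \<and> kummer \<alpha> \<gamma> z = 0}"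
proof -
  have "\<not> kummer \<alpha> \<gamma> constant_on UNIV" if "kummer \<alpha> \<gamma> w = 0" for w
    using that kummer_0[of \<alpha> \<gamma>] unfolding constant_on_def by (metis UNIV_I zero_neq_one)
  then have "finite {z \<in> cball 0 r. kummer \<alpha> \<gamma> z = 0}" if "kummer \<alpha> \<gamma> w = 0" for w
    using that by (intro holomorphic_compact_finite_zeros[where S = UNIV] kummer_holomorphic assms) auto
  then have "finite {z \<in> cball 0 r. kummer \<alpha> \<gamma> z = 0}"
    by (cases "\<exists>w. kummer \<alpha> \<gamma> w = 0") auto
  then show ?thesis
    by simp
qed

lemma finite_inverse_kummer_poles:
  assumes "\<gamma> \<notin> \<int>\<^sub>\<le>\<^sub>0"
  shows "finite {p. norm p \<le> r \<and> is_pole (\<lambda>z. 1 / kummer \<alpha> \<gamma> z) p}"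
proof (rule finite_subset[OF _ finite_kummer_zeros[OF assms]])
  have "kummer \<alpha> \<gamma> p = 0" if "is_pole (\<lambda>z. 1 / kummer \<alpha> \<gamma> z) p" for p
  proof (rule ccontr)
    assume "kummer \<alpha> \<gamma> p \<noteq> 0"
    moreover have "isCont (kummer \<alpha> \<gamma>) p"
      using kummer_holomorphic[OF assms, of \<alpha> UNIV] holomorphic_on_imp_continuous_on
        continuous_on_eq_continuous_at open_UNIV by blast
    ultimately have "isCont (\<lambda>z. 1 / kummer \<alpha> \<gamma> z) p"
      by (intro continuous_intros) auto
    then show False
      using that unfolding is_pole_def isCont_def
      using not_tendsto_and_filterlim_at_infinity trivial_limit_at by blast
  qed
  then show "{p. norm p \<le> r \<and> is_pole (\<lambda>z. 1 / kummer \<alpha> \<gamma> z) p}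
      \<subseteq> {z. norm z \<le> r \<and> kummer \<alpha> \<gamma> z = 0}"
    by blast
qed

end

theory Submission
  imports Defs
begin

text \<open>
  The zeros of an entire function of exponential type have at most linear density, and the Kummer
  function is of exponential type.

  The ratio of consecutive coefficients of the series is $(\alpha + n)/((\gamma + n)(n + 1))$, and
  $(\alpha + n)/(\gamma + n)$ tends to $1$, so it is bounded by some \<open>K\<close>. Hence the series is
  dominated termwise by that of $e^{K |z|}$ (\<open>kummer_exponential_type\<close>).

  The link between growth and zeros is a crude form of Jensen's inequality
  (\<open>zero_count_maximum_modulus\<close>). Split off the zeros in $|z| \leq r$ as a polynomial \<open>P\<close>, so
  $f = g P$ with \<open>g\<close> entire. On the circle $|z| = 3r$ every factor of \<open>P\<close> satisfies
  $|z - a| \geq 2 |a|$, that is, it is at least twice as large as at the origin, so $|P|$ has grown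
  by $2^{n(r)}$; the maximum principle for \<open>g\<close> then gives
  $|f(0)| \, 2^{n(r)} \leq \max_{|z| = 3r} |f(z)|$. With $f(0) = 1$ and the exponential bound,
  $n(r) \log 2 \leq 3 K r$, which is stronger than $O(r^{1 + \epsilon})$.

  That the poles of $1/f$ match the nonzero zeros of \<open>f\<close> with multiplicity
  (\<open>pole_count_inverse_entire\<close>) only uses $f(0) \neq 0$.
\<close>

section \<open>Zeros of entire functions and their multiplicities\<close>

lemma entire_eventually_nonzero:
  assumes "f holomorphic_on UNIV" "f w \<noteq> 0"
  shows "eventually (\<lambda>z. f z \<noteq> 0) (at a)"
  using non_zero_neighbour_alt[of f UNIV a w] assms by auto

lemma entire_analytic_at:
  assumes "f holomorphic_on UNIV"
  shows "f analytic_on {a}"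
  using assms analytic_at by blast

text \<open>
  The quotient $f(z)/(z-a)^n$ is analytic away from \<open>a\<close>; near \<open>a\<close> it agrees with the local
  cofactor \<open>zor_poly f a\<close>, which supplies its value at \<open>a\<close>.
\<close>

lemma entire_divide_zero:
  assumes holo: "f holomorphic_on UNIV" and nz: "f w \<noteq> 0"
  obtains g where "g holomorphic_on UNIV" "\<And>z. f z = g z * (z - a) ^ nat (zorder f a)"
proof -
  define n where "n = nat (zorder f a)"
  obtain r where r: "r > 0" "zor_poly f a holomorphic_on cball a r"
      "\<And>w. w \<in> cball a r \<Longrightarrow> f w = zor_poly f a w * (w - a) ^ n"
    using zorder_exist_zero[OF holo open_UNIV connected_UNIV UNIV_I, of a] nz
    unfolding n_def by blast
  define g where "g z = (if z = a then zor_poly f a a else f z / (z - a) ^ n)" for z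
  have "g holomorphic_on ball a r"
  proof (rule holomorphic_transform)
    show "zor_poly f a holomorphic_on ball a r"
      using r(2) by (rule holomorphic_on_subset) auto
    show "zor_poly f a z = g z" if "z \<in> ball a r" for z
      using r(3)[of z] that by (auto simp: g_def)
  qed
  moreover have "g holomorphic_on - {a}"
  proof (rule holomorphic_transform)
    show "(\<lambda>z. f z / (z - a) ^ n) holomorphic_on - {a}"
      by (intro holomorphic_intros holomorphic_on_subset[OF holo]) auto
  qed (auto simp: g_def)
  ultimately have "g holomorphic_on ball a r \<union> - {a}"
    by (rule holomorphic_on_Un) auto
  moreover have "ball a r \<union> - {a} = UNIV"
    using r(1) by auto
  ultimately have "g holomorphic_on UNIV"
    by simp
  moreover have "f z = g z * (z - a) ^ nat (zorder f a)" for z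
    using r(1) r(3)[of a] by (cases "z = a") (auto simp: g_def n_def)
  ultimately show ?thesis
    by (rule that)
qed

text \<open>
  Points are split off one at a time. The part already removed does not vanish at the next point,
  so the cofactor still has the multiplicity of \<open>f\<close> there.
\<close>

lemma entire_divide_zeros:
  assumes "finite A" and holo: "f holomorphic_on UNIV" and nz: "f w \<noteq> 0"
  obtains g where "g holomorphic_on UNIV"
    "\<And>z. f z = g z * (\<Prod>a\<in>A. (z - a) ^ nat (zorder f a))"
proof -
  have "\<exists>g. g holomorphic_on UNIV \<and> (\<forall>z. f z = g z * (\<Prod>a\<in>A. (z - a) ^ nat (zorder f a)))"
    using \<open>finite A\<close>
  proof induction
    case empty
    show ?case
      using holo by (intro exI[of _ f]) simp
  next
    case (insert b A)
    define P where "P z = (\<Prod>a\<in>A. (z - a) ^ nat (zorder f a))" for z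
    obtain g where g: "g holomorphic_on UNIV" "\<And>z. f z = g z * P z"
      using insert.IH unfolding P_def by blast
    have holoP: "P holomorphic_on UNIV"
      unfolding P_def by (intro holomorphic_intros)
    have "P b \<noteq> 0"
      using insert.hyps by (auto simp: P_def)
    then have "zorder P b = 0"
      by (intro zorder_eq_0I entire_analytic_at holoP)
    moreover have "zorder (\<lambda>z. g z * P z) b = zorder g b + zorder P b"
      using entire_eventually_nonzero[OF holo nz, of b] g
      by (intro zorder_times_analytic entire_analytic_at holoP) auto
    moreover have "f = (\<lambda>z. g z * P z)"
      using g(2) by blast
    ultimately have ord: "zorder f b = zorder g b"
      by simp
    have "g w \<noteq> 0"
      using nz g(2)[of w] by auto
    then obtain h where h: "h holomorphic_on UNIV" "\<And>z. g z = h z * (z - b) ^ nat (zorder g b)"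
      using entire_divide_zero[OF g(1)] by blast
    have "f z = h z * (\<Prod>a\<in>insert b A. (z - a) ^ nat (zorder f a))" for z
      unfolding prod.insert[OF insert.hyps] g(2)[of z] h(2)[of z] ord P_def
      by (simp only: mult.assoc)
    then show ?case
      using h(1) by blast
  qed
  then show ?thesis
    using that by blast
qed

lemma finite_entire_zeros:
  assumes holo: "f holomorphic_on UNIV" and nz: "f w \<noteq> 0"
  shows "finite {z. norm z \<le> r \<and> f z = 0}"
proof (cases "\<exists>v. f v = 0")
  case True
  then have "\<not> f constant_on UNIV"
    using nz unfolding constant_on_def by (metis UNIV_I)
  then have "finite {z \<in> cball 0 r. f z = 0}"
    by (intro holomorphic_compact_finite_zeros[OF holo]) auto
  then show ?thesis
    by simp
qed auto

lemma pole_count_inverse_entire: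
  assumes holo: "f holomorphic_on UNIV" and nz: "f 0 \<noteq> 0"
  shows "pole_count (\<lambda>z. 1 / f z) r = nonzero_zero_count f r"
proof -
  have inv: "(\<lambda>z. 1 / f z) = (\<lambda>z. inverse (f z))"
    by (simp add: divide_inverse)
  have "is_pole (\<lambda>z. 1 / f z) z \<longleftrightarrow> f z = 0" for z
  proof -
    have "isCont f z"
      by (intro analytic_at_imp_isCont entire_analytic_at holo)
    then show ?thesis
      using entire_eventually_nonzero[OF holo nz, of z] zero_isolated_zero[of f z]
      unfolding inv is_pole_inverse_iff by (metis isolated_zero_def isCont_def)
  qed
  then have "{p. norm p \<le> r \<and> is_pole (\<lambda>z. 1 / f z) p} = {z. norm z \<le> r \<and> z \<noteq> 0 \<and> f z = 0}"
    using nz by auto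
  moreover have "zorder (\<lambda>z. 1 / f z) z = - zorder f z" for z
    unfolding inv
    using entire_eventually_nonzero[OF holo nz, of z] entire_analytic_at[OF holo, of z]
    by (intro zorder_inverse isolated_singularity_at_analytic not_essential_analytic
          eventually_frequently) auto
  ultimately show ?thesis
    by (simp add: pole_count_def nonzero_zero_count_def)
qed

section \<open>Growth bounds the number of zeros\<close>

text \<open>
  The radius \<open>3 * r\<close> makes each linear factor of the zero polynomial at least double between the
  origin and the circle. This avoids both the Blaschke factors and the integral of Jensen's formula,
  at the price of a constant.
\<close>

lemma zero_count_maximum_modulus:
  assumes holo: "f holomorphic_on UNIV" and nz: "f 0 \<noteq> 0" and r: "r > 0"
    and bound: "\<And>z. norm z = 3 * r \<Longrightarrow> norm (f z) \<le> M"
  shows "norm (f 0) * 2 ^ nonzero_zero_count f r \<le> M"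
proof -
  define Z where "Z = {z. norm z \<le> r \<and> z \<noteq> 0 \<and> f z = 0}"
  define m where "m a = nat (zorder f a)" for a
  define N where "N = nonzero_zero_count f r"
  define P where "P z = (\<Prod>a\<in>Z. (z - a) ^ m a)" for z
  have "finite Z"
    unfolding Z_def by (rule finite_subset[OF _ finite_entire_zeros[OF holo nz, of r]]) auto
  then obtain g where g: "g holomorphic_on UNIV" "\<And>z. f z = g z * P z"
    using entire_divide_zeros[OF _ holo nz] unfolding P_def m_def by blast
  have N: "N = (\<Sum>a\<in>Z. m a)"
    by (simp add: N_def nonzero_zero_count_def Z_def m_def)
  have P0: "norm (P 0) > 0"
    using \<open>finite Z\<close> by (auto simp: P_def Z_def)
  have P_grows: "2 ^ N * norm (P 0) \<le> norm (P z)" if z: "norm z = 3 * r" for z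
  proof -
    have "2 ^ N * norm (P 0) = (\<Prod>a\<in>Z. (2 * norm a) ^ m a)"
      by (simp add: N P_def power_sum prod.distrib power_mult_distrib prod_norm[symmetric]
          norm_power)
    also have "\<dots> \<le> (\<Prod>a\<in>Z. norm (z - a) ^ m a)"
    proof (intro prod_mono conjI power_mono)
      show "2 * norm a \<le> norm (z - a)" if "a \<in> Z" for a
        using norm_triangle_ineq2[of z a] that z by (auto simp: Z_def)
    qed auto
    also have "\<dots> = norm (P z)"
      by (simp add: P_def prod_norm[symmetric] norm_power)
    finally show ?thesis .
  qed
  have "norm (g 0) \<le> M / (2 ^ N * norm (P 0))"
  proof (rule maximum_modulus_frontier[of g "cball 0 (3 * r)"])
    fix z :: complex
    assume "z \<in> frontier (cball 0 (3 * r))"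
    then have z: "norm z = 3 * r"
      by (simp add: frontier_def)
    have "norm (g z) * (2 ^ N * norm (P 0)) \<le> norm (g z) * norm (P z)"
      by (intro mult_left_mono P_grows z) auto
    also have "\<dots> \<le> M"
      using bound[OF z] by (simp add: g(2) norm_mult)
    finally show "norm (g z) \<le> M / (2 ^ N * norm (P 0))"
      using P0 by (simp add: pos_le_divide_eq)
  qed (use r g(1) in \<open>auto intro: holomorphic_on_subset holomorphic_on_imp_continuous_on\<close>)
  then have "norm (g 0) * (2 ^ N * norm (P 0)) \<le> M"
    using P0 by (simp add: pos_le_divide_eq)
  then show ?thesis
    by (simp add: g(2) norm_mult N_def mult_ac)
qed

lemma zero_count_exponential_type:
  assumes holo: "f holomorphic_on UNIV" and f0: "f 0 = 1" and r: "r > 0"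
    and bound: "\<And>z. norm (f z) \<le> exp (K * norm z)"
  shows "real (nonzero_zero_count f r) \<le> 3 * K / ln 2 * r"
proof -
  have "norm (f z) \<le> exp (K * (3 * r))" if "norm z = 3 * r" for z
    using bound[of z] that by simp
  then have "norm (f 0) * 2 ^ nonzero_zero_count f r \<le> exp (K * (3 * r))"
    by (intro zero_count_maximum_modulus holo r) (auto simp: f0)
  then have "ln (2 ^ nonzero_zero_count f r :: real) \<le> ln (exp (K * (3 * r)))"
    by (subst ln_le_cancel_iff) (auto simp: f0)
  then show ?thesis
    by (simp add: ln_realpow field_simps)
qed

section \<open>Growth of the Kummer function\<close>

lemma bounded_shift_quotient:
  fixes \<alpha> \<gamma> :: complex
  obtains K where "\<And>n::nat. norm ((\<alpha> + of_nat n) / (\<gamma> + of_nat n)) \<le> K"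
proof -
  have "(\<lambda>n::nat. (\<alpha> + of_nat n) / (\<gamma> + of_nat n)) \<longlonglongrightarrow> 1"
  proof (rule Lim_transform_eventually)
    show "(\<lambda>n::nat. (\<alpha> / of_nat n + 1) / (\<gamma> / of_nat n + 1)) \<longlonglongrightarrow> 1"
      by (rule tendsto_eq_intros lim_const_over_n refl | simp)+
    show "\<forall>\<^sub>F n::nat in sequentially.
        (\<alpha> / of_nat n + 1) / (\<gamma> / of_nat n + 1) = (\<alpha> + of_nat n) / (\<gamma> + of_nat n)"
      using eventually_gt_at_top[of 0]
    proof eventually_elim
      case (elim n)
      then have "\<alpha> / of_nat n + 1 = (\<alpha> + of_nat n) / of_nat n"
        "\<gamma> / of_nat n + 1 = (\<gamma> + of_nat n) / of_nat n"
        by (simp_all add: field_simps)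
      then show ?case
        using elim by simp
    qed
  qed
  then have "Bseq (\<lambda>n::nat. (\<alpha> + of_nat n) / (\<gamma> + of_nat n))"
    using convergent_imp_Bseq convergentI by blast
  then show ?thesis
    using that unfolding Bseq_def by blast
qed

lemma kummer_exponential_type:
  assumes "\<gamma> \<notin> \<int>\<^sub>\<le>\<^sub>0"
  obtains K where "\<And>z. norm (kummer \<alpha> \<gamma> z) \<le> exp (K * norm z)"
proof -
  obtain K where K: "\<And>n::nat. norm ((\<alpha> + of_nat n) / (\<gamma> + of_nat n)) \<le> K"
    using bounded_shift_quotient[of \<alpha> \<gamma>] by blast
  have coeff: "norm (pochhammer \<alpha> n / pochhammer \<gamma> n) \<le> K ^ n" for n
  proof -
    have "pochhammer \<alpha> n / pochhammer \<gamma> n = (\<Prod>i<n. (\<alpha> + of_nat i) / (\<gamma> + of_nat i))"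
      by (simp add: pochhammer_prod prod_dividef atLeast0LessThan)
    then have "norm (pochhammer \<alpha> n / pochhammer \<gamma> n)
        = (\<Prod>i<n. norm ((\<alpha> + of_nat i) / (\<gamma> + of_nat i)))"
      by (simp add: prod_norm)
    also have "\<dots> \<le> (\<Prod>i<n. K)"
      using K by (intro prod_mono) auto
    finally show ?thesis
      by simp
  qed
  have "norm (kummer \<alpha> \<gamma> z) \<le> exp (K * norm z)" for z
  proof -
    let ?c = "\<lambda>n. pochhammer \<alpha> n / (fact n * pochhammer \<gamma> n) * z ^ n"
    have "norm (?c n) \<le> (K * norm z) ^ n /\<^sub>R fact n" for n
    proof -
      have "norm (?c n) = norm (pochhammer \<alpha> n / pochhammer \<gamma> n) * (norm z ^ n / fact n)"
        by (simp add: norm_mult norm_divide norm_power)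
      also have "\<dots> \<le> K ^ n * (norm z ^ n / fact n)"
        by (intro mult_right_mono coeff) auto
      finally show ?thesis
        by (simp add: power_mult_distrib field_simps)
    qed
    then have "norm (suminf ?c) \<le> (\<Sum>n. (K * norm z) ^ n /\<^sub>R fact n)"
      by (intro norm_suminf_le summable_exp_generic)
    then show ?thesis
      by (simp add: kummer_def exp_def)
  qed
  then show ?thesis
    by (rule that)
qed

section \<open>Counting the zeros of the Kummer function\<close>

theorem theorem4p3:
  fixes \<alpha> \<gamma> :: complex
  assumes "\<gamma> \<notin> \<int>\<^sub>\<le>\<^sub>0"
    and "\<alpha> \<notin> \<int>\<^sub>\<le>\<^sub>0"
    and "\<gamma> - \<alpha> \<notin> \<int>\<^sub>\<le>\<^sub>0"
  shows "\<forall>\<epsilon>>0.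
      (\<forall>\<^sub>F r in at_top. pole_count (\<lambda>z. 1 / kummer \<alpha> \<gamma> z) r = nonzero_zero_count (kummer \<alpha> \<gamma>) r)
    \<and> (\<lambda>r. real (nonzero_zero_count (kummer \<alpha> \<gamma>) r)) \<in> O[at_top](\<lambda>r. r powr (1 + \<epsilon>))"
proof (intro allI impI conjI)
  fix \<epsilon> :: real
  assume \<epsilon>: "\<epsilon> > 0"
  have holo: "kummer \<alpha> \<gamma> holomorphic_on UNIV"
    by (rule kummer_holomorphic[OF assms(1)])
  show "\<forall>\<^sub>F r in at_top.
      pole_count (\<lambda>z. 1 / kummer \<alpha> \<gamma> z) r = nonzero_zero_count (kummer \<alpha> \<gamma>) r"
    by (intro always_eventually allI pole_count_inverse_entire[OF holo]) simp
  obtain K where K: "\<And>z. norm (kummer \<alpha> \<gamma> z) \<le> exp (K * norm z)"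
    using kummer_exponential_type[OF assms(1), of \<alpha>] by blast
  show "(\<lambda>r. real (nonzero_zero_count (kummer \<alpha> \<gamma>) r)) \<in> O[at_top](\<lambda>r. r powr (1 + \<epsilon>))"
  proof (rule bigoI)
    show "\<forall>\<^sub>F r in at_top. norm (real (nonzero_zero_count (kummer \<alpha> \<gamma>) r))
        \<le> \<bar>3 * K / ln 2\<bar> * norm (r powr (1 + \<epsilon>))"
      using eventually_ge_at_top[of 1]
    proof eventually_elim
      case (elim r)
      have "real (nonzero_zero_count (kummer \<alpha> \<gamma>) r) \<le> 3 * K / ln 2 * r"
        by (rule zero_count_exponential_type[OF holo kummer_0 _ K]) (use elim in auto)
      also have "\<dots> \<le> \<bar>3 * K / ln 2\<bar> * r"
        using elim by (intro mult_right_mono abs_ge_self) simp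
      also have "\<dots> \<le> \<bar>3 * K / ln 2\<bar> * r powr (1 + \<epsilon>)"
        using powr_mono[of 1 "1 + \<epsilon>" r] elim \<epsilon> by (intro mult_left_mono abs_ge_zero) simp
      finally show ?case
        by simp
    qed
  qed
qed

end
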